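(* A parabola is the most curved planar curve that is complete and embedded as a closed subset of the plane.
   Context: Planar curves are smooth curves in $\mathbb{R}^2$ parametrized by arclength $s$, and the curvature of such a curve $C$ is $\kappa(s)=|C''(s)|$. A curve is said to be more curved than a parabola $P$ (parametrized by arclength, with curvature function $\kappa_P$) if its curvature function $\kappa(s)$ exceeds $\kappa_P(s)$, where a function $f$ exceeds a function $g$ if $f(x)\ge g(x)$ for all $x$ and $f(x)>g(x)$ for some $x$. Embedded means that the curve is a homeomorphism onto its image equipped with the topology inherited from the plane. *)

theory Defs
  imports "HOL-Analysis.Analysis"
begin

definition iter_deriv :: "nat \<Rightarrow> (real \<Rightarrow> real^2) \<Rightarrow> real \<Rightarrow> real^2" where
  "iter_deriv n C = ((\<lambda>f s. vector_derivative f (at s)) ^^ n) C"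

text \<open>A planar curve is given by its arclength parametrization \<open>C\<close> on its parameter domain \<open>I\<close>,
  a nonempty open interval, possibly unbounded.  Smooth means of class \<open>C\<^sup>\<infinity>\<close>; since \<open>I\<close> is open,
  only the values of \<open>C\<close> on \<open>I\<close> matter below.\<close>

definition planar_curve :: "real set \<Rightarrow> (real \<Rightarrow> real^2) \<Rightarrow> bool" where
  "planar_curve I C \<longleftrightarrow>
     I \<noteq> {} \<and> open I \<and> connected I \<and>
     (\<forall>n. \<forall>s\<in>I. iter_deriv n C differentiable (at s)) \<and>
     (\<forall>s\<in>I. norm (iter_deriv 1 C s) = 1)"

definition curvature :: "(real \<Rightarrow> real^2) \<Rightarrow> real \<Rightarrow> real" where
  "curvature C s = norm (iter_deriv 2 C s)"

text \<open>Arclength identifies the intrinsic metric of a curve with the usual metric of its parameter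
  interval, so the curve is complete iff \<open>I\<close> is complete as a metric space (for an open
  interval: iff \<open>I\<close> is the whole real line).\<close>

definition complete_curve :: "real set \<Rightarrow> (real \<Rightarrow> real^2) \<Rightarrow> bool" where
  "complete_curve I C \<longleftrightarrow> planar_curve I C \<and> complete I"

definition embedded_curve :: "real set \<Rightarrow> (real \<Rightarrow> real^2) \<Rightarrow> bool" where
  "embedded_curve I C \<longleftrightarrow> (\<exists>g. homeomorphism I (C ` I) C g)"

definition parabola :: "(real^2) set \<Rightarrow> bool" where
  "parabola S \<longleftrightarrow>
     (\<exists>F L. affine L \<and> aff_dim L = 1 \<and> F \<notin> L \<and> S = {x. dist x F = infdist x L})"

definition exceeds_on :: "real set \<Rightarrow> (real \<Rightarrow> real) \<Rightarrow> (real \<Rightarrow> real) \<Rightarrow> bool" where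
  "exceeds_on D f g \<longleftrightarrow> (\<forall>x\<in>D. f x \<ge> g x) \<and> (\<exists>x\<in>D. f x > g x)"

text \<open>Curvature functions are compared at equal parameter values, hence on a common domain.\<close>

definition more_curved :: "real set \<Rightarrow> (real \<Rightarrow> real^2) \<Rightarrow> real set \<Rightarrow> (real \<Rightarrow> real^2) \<Rightarrow> bool" where
  "more_curved I C J P \<longleftrightarrow> I = J \<and> exceeds_on J (curvature C) (curvature P)"

definition complete_closed_embedded :: "real set \<Rightarrow> (real \<Rightarrow> real^2) \<Rightarrow> bool" where
  "complete_closed_embedded I C \<longleftrightarrow>
     complete_curve I C \<and> embedded_curve I C \<and> closed (C ` I)"

end

theory Submission
  imports Defs
begin

text \<open>A curve whose curvature dominates that of the parabola has nowhere vanishing curvature, so up to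
  a reflection it turns left all the time and has an increasing tangent angle \<open>\<theta>\<close> with
  \<open>\<theta>' = \<kappa>\<close>.  For the parabola the angle is \<open>arctan (u / d)\<close>, where
  \<open>u\<close> is the coordinate parallel to the directrix and \<open>d\<close> the distance from the focus to the
  directrix, so its total variation is exactly \<open>\<pi>\<close>; a strictly larger curvature function would therefore produce a total turning larger
  than \<open>\<pi>\<close>.

  A left-turning curve that is injective and tends to infinity at both ends turns by at most
  \<open>\<pi>\<close>.  Cut the curve into arcs on which the height \<open>y\<close> is monotone.  Three consecutive extrema
  \<open>p0\<close>, \<open>p1\<close>, \<open>p2\<close> with \<open>y p0 \<le> y p2\<close> (minimum, maximum, minimum) trap the next arc between
  the two previous ones, since by the intermediate value theorem it could only leave by crossing
  them.  By induction the rest of the curve stays in a box; if instead \<open>y p2 \<le> y p0\<close> the same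
  happens backwards in time.  Hence the turning is less than \<open>2\<pi>\<close>.  If it exceeds \<open>\<pi>\<close>, rotate the
  curve so that the middle of the range of its angle becomes \<open>\<pi> / 2\<close>: then the height runs from
  \<open>+\<infinity>\<close> to \<open>-\<infinity>\<close> along the two ends, contradicting the same trapping property.\<close>

section \<open>Left-turning curves\<close>

text \<open>\<open>\<theta>\<close> is a lift of the tangent direction, not reduced modulo
  \<open>2 * pi\<close>, so turning is a difference of its values. Positive curvature is encoded as
  strict monotonicity of \<open>\<theta>\<close>.\<close>

definition left_turning :: "(real \<Rightarrow> real) \<Rightarrow> (real \<Rightarrow> real) \<Rightarrow> (real \<Rightarrow> real) \<Rightarrow> bool" where
  "left_turning \<theta> x y \<longleftrightarrow>
     continuous_on UNIV \<theta> \<and> strict_mono \<theta> \<and>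
     (\<forall>s. (x has_real_derivative cos (\<theta> s)) (at s)) \<and>
     (\<forall>s. (y has_real_derivative sin (\<theta> s)) (at s)) \<and>
     inj (\<lambda>s. (x s, y s))"

lemma left_turningD:
  assumes "left_turning \<theta> x y"
  shows "continuous_on A \<theta>" "s < t \<Longrightarrow> \<theta> s < \<theta> t" "s \<le> t \<Longrightarrow> \<theta> s \<le> \<theta> t"
    "(x has_real_derivative cos (\<theta> s)) (at s)"
    "(y has_real_derivative sin (\<theta> s)) (at s)"
    "x s = x t \<Longrightarrow> y s = y t \<Longrightarrow> s = t"
    "continuous_on A x" "continuous_on A y"
proof -
  have \<theta>: "continuous_on UNIV \<theta>" "strict_mono \<theta>"
    and x: "\<And>s. (x has_real_derivative cos (\<theta> s)) (at s)"
    and y: "\<And>s. (y has_real_derivative sin (\<theta> s)) (at s)"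
    and inj: "inj (\<lambda>s. (x s, y s))"
    using assms unfolding left_turning_def by blast+
  show "continuous_on A \<theta>" using \<theta>(1) continuous_on_subset by blast
  show "s < t \<Longrightarrow> \<theta> s < \<theta> t" "s \<le> t \<Longrightarrow> \<theta> s \<le> \<theta> t"
    using \<theta>(2) by (auto simp: strict_mono_def strict_mono_less_eq)
  show "(x has_real_derivative cos (\<theta> s)) (at s)" by (rule x)
  show "(y has_real_derivative sin (\<theta> s)) (at s)" by (rule y)
  show "s = t" if "x s = x t" "y s = y t"
    using injD[OF inj, of s t] that by blast
  show "continuous_on A x" by (rule DERIV_continuous_on) (rule has_field_derivative_at_within[OF x])
  show "continuous_on A y" by (rule DERIV_continuous_on) (rule has_field_derivative_at_within[OF y])
qed

text \<open>By the addition formulas, rotating the plane by \<open>c\<close> adds \<open>c\<close>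
  to the tangent angle. Later arguments use this to start at a prescribed angle.\<close>

lemma left_turning_rotate:
  assumes "left_turning \<theta> x y"
  shows "left_turning (\<lambda>s. \<theta> s + c) (\<lambda>s. cos c * x s - sin c * y s) (\<lambda>s. sin c * x s + cos c * y s)"
proof -
  note D = left_turningD[OF assms]
  have *: "s = t" if "cos c * x s - sin c * y s = cos c * x t - sin c * y t"
    "sin c * x s + cos c * y s = sin c * x t + cos c * y t" for s t
  proof (rule D(6))
    \<comment> \<open>The rotated difference vector is zero; \<open>split\<close> combines both
      equations to show that the original one is zero too.\<close>
    have 1: "cos c * (x s - x t) = sin c * (y s - y t)" "cos c * (y s - y t) = - sin c * (x s - x t)"
      unfolding right_diff_distrib mult_minus_left using that by linarith+
    have split: "d = cos c * (cos c * d) + sin c * (sin c * d)" for d :: real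
    proof -
      have "((cos c)\<^sup>2 + (sin c)\<^sup>2) * d = cos c * (cos c * d) + sin c * (sin c * d)"
        by (simp only: power2_eq_square distrib_right mult.assoc)
      then show ?thesis by (simp only: sin_cos_squared_add2 mult_1)
    qed
    have "x s - x t = cos c * (sin c * (y s - y t)) + sin c * (sin c * (x s - x t))"
      using split[of "x s - x t"] by (simp only: 1(1))
    also have "\<dots> = sin c * (cos c * (y s - y t)) + sin c * (sin c * (x s - x t))"
      by (simp only: mult.left_commute)
    also have "\<dots> = 0" unfolding 1(2) by simp
    finally show "x s = x t" by (simp only: right_minus_eq)
    have "y s - y t = cos c * (- sin c * (x s - x t)) + sin c * (sin c * (y s - y t))"
      using split[of "y s - y t"] by (simp only: 1(2))
    also have "\<dots> = - sin c * (cos c * (x s - x t)) + sin c * (sin c * (y s - y t))"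
      by (simp only: mult.left_commute)
    also have "\<dots> = 0" unfolding 1(1) by simp
    finally show "y s = y t" by (simp only: right_minus_eq)
  qed
  have "inj (\<lambda>s. (cos c * x s - sin c * y s, sin c * x s + cos c * y s))"
    by (rule injI, rule *) simp_all
  moreover have "((\<lambda>s. cos c * x s - sin c * y s) has_real_derivative cos (\<theta> s + c)) (at s)" for s
    unfolding cos_add using DERIV_diff[OF DERIV_cmult[OF D(4)[of s], of "cos c"] DERIV_cmult[OF D(5)[of s], of "sin c"]]
    by (simp add: mult.commute)
  moreover have "((\<lambda>s. sin c * x s + cos c * y s) has_real_derivative sin (\<theta> s + c)) (at s)" for s
    unfolding sin_add using DERIV_add[OF DERIV_cmult[OF D(4)[of s], of "sin c"] DERIV_cmult[OF D(5)[of s], of "cos c"]]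
    by (simp add: algebra_simps)
  moreover have "continuous_on UNIV (\<lambda>s. \<theta> s + c)"
    by (intro continuous_intros D(1))
  moreover have "strict_mono (\<lambda>s. \<theta> s + c)"
    by (rule strict_monoI) (simp add: D(2))
  ultimately show ?thesis
    unfolding left_turning_def by blast
qed

text \<open>Half turns exchange minima and maxima of the height, so facts on ascending arcs transfer
  to descending ones and an induction can advance by one arc.\<close>

lemma left_turning_half_turn:
  assumes "left_turning \<theta> x y"
  shows "left_turning (\<lambda>s. \<theta> s - pi) (\<lambda>s. - x s) (\<lambda>s. - y s)"
  using left_turning_rotate[OF assms, of "-pi"] by (simp only: cos_minus sin_minus cos_pi sin_pi) simp

text \<open>Reversing time alone would give a right-turning curve; the reflection restores the orientation
  and preserves heights.\<close>

lemma left_turning_reverse: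
  assumes "left_turning \<theta> x y"
  shows "left_turning (\<lambda>s. - \<theta> (- s)) (\<lambda>s. - x (- s)) (\<lambda>s. y (- s))"
proof -
  note D = left_turningD[OF assms]
  have "continuous_on UNIV (\<lambda>s. - \<theta> (- s))"
    by (intro continuous_on_minus continuous_on_compose2[OF D(1)[of UNIV]] continuous_on_id) simp
  moreover have "((\<lambda>s. - x (- s)) has_real_derivative cos (- \<theta> (- s))) (at s)" for s
    using DERIV_minus[OF DERIV_chain2[OF D(4)[of "- s"] DERIV_minus[OF DERIV_ident]]] by simp
  moreover have "((\<lambda>s. y (- s)) has_real_derivative sin (- \<theta> (- s))) (at s)" for s
    using DERIV_chain2[OF D(5)[of "- s"] DERIV_minus[OF DERIV_ident]] by simp
  moreover have "inj (\<lambda>s. (- x (- s), y (- s)))"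
    by (rule injI, rule neg_equal_iff_equal[THEN iffD1], rule D(6)) simp_all
  moreover have "strict_mono (\<lambda>s. - \<theta> (- s))"
    by (rule strict_monoI) (simp add: D(2))
  ultimately show ?thesis
    unfolding left_turning_def by blast
qed

text \<open>The sine is positive strictly between \<open>0\<close> and \<open>pi\<close>; it may
  vanish at the ends of the arc, so the derivative test looks at interior points only.\<close>

lemma left_turning_ascend:
  assumes "left_turning \<theta> x y" "0 \<le> \<theta> a" "\<theta> b \<le> pi" "a \<le> s" "s < t" "t \<le> b"
  shows "y s < y t"
proof (rule DERIV_pos_imp_increasing_open[OF \<open>s < t\<close>])
  note D = left_turningD[OF assms(1)]
  show "continuous_on {s..t} y" by (rule D)
  fix z assume z: "s < z" "z < t"
  have "0 < \<theta> z" "\<theta> z < pi"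
    using D(2)[of a z] D(2)[of z b] assms z by linarith+
  then show "\<exists>d. DERIV y z :> d \<and> 0 < d"
    using D(5)[of z] sin_gt_zero by blast
qed

lemma left_turning_descend:
  assumes "left_turning \<theta> x y" "pi \<le> \<theta> a" "\<theta> b \<le> 2 * pi" "a \<le> s" "s < t" "t \<le> b"
  shows "y t < y s"
  using left_turning_ascend[OF left_turning_half_turn[OF assms(1)], of a b s t] assms by simp

lemma left_turning_angle_ivt:
  assumes "left_turning \<theta> x y" "\<theta> s < c" "c < \<theta> t"
  obtains p where "s < p" "p < t" "\<theta> p = c"
proof -
  note D = left_turningD[OF assms(1)]
  have "s < t" using assms D(3)[of t s] by linarith
  then obtain p where "s \<le> p" "p \<le> t" "\<theta> p = c"
    using IVT'[of \<theta> s c t, OF _ _ _ D(1)] assms by auto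
  moreover have "s \<noteq> p" "p \<noteq> t" using calculation assms by auto
  ultimately show ?thesis using that by force
qed

section \<open>Trapping between monotone arcs\<close>

text \<open>At the top \<open>q\<close> of the arc the curve moves to the left, so it starts out on the left of the arc;
  a change of side would be a self-intersection.\<close>

lemma side_of_ascending_arm:
  assumes "left_turning \<theta> x y" "p < q" "0 \<le> \<theta> p" "\<theta> q = pi"
    and path: "\<And>t. q < t \<Longrightarrow> t \<le> s \<Longrightarrow> y p \<le> y t \<and> y t \<le> y q"
    and "q < s" "p \<le> u" "u \<le> q" "y u = y s"
  shows "x s < x u"
proof (rule ccontr)
  assume neg: "\<not> x s < x u"
  note D = left_turningD[OF assms(1)]
  have mono: "y t < y t'" if "p \<le> t" "t < t'" "t' \<le> q" for t t'
    using left_turning_ascend[OF assms(1,3) _ that] assms(4) by simp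
  \<comment> \<open>\<open>\<sigma> (y t)\<close> is the parameter of the arc point level with the
    point at time \<open>t\<close>; comparing their abscissas tells the side of the arc.\<close>
  define \<sigma> where "\<sigma> = the_inv_into {p..q} y"
  have inj: "inj_on y {p..q}"
  proof (rule inj_onI)
    fix a b assume "a \<in> {p..q}" "b \<in> {p..q}" "y a = y b"
    then show "a = b" using mono[of a b] mono[of b a] by (cases a b rule: linorder_cases) auto
  qed
  have \<sigma>: "\<sigma> (y t) = t" if "t \<in> {p..q}" for t
    unfolding \<sigma>_def using the_inv_into_f_f[OF inj that] .
  have cont_\<sigma>: "continuous_on (y ` {p..q}) \<sigma>"
    by (rule continuous_on_inv) (use D(8) \<sigma> in auto)
  have im: "y t \<in> y ` {p..q}" if qt: "q \<le> t" "t \<le> s" for t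
  proof (cases "t = q")
    case False
    then obtain z where "p \<le> z" "z \<le> q" "y z = y t"
      using IVT'[of y p "y t" q, OF _ _ _ D(8)] path[of t] qt assms(2) by auto
    then show ?thesis by (metis atLeastAtMost_iff imageI)
  qed (use assms in auto)
  have \<sigma>_in: "\<sigma> (y t) \<in> {p..q}" "y (\<sigma> (y t)) = y t" if "q \<le> t" "t \<le> s" for t
    using im[OF that] \<sigma> by auto
  have cont: "continuous_on {q..s} (\<lambda>t. \<sigma> (y t))"
    by (rule continuous_on_compose2[OF cont_\<sigma> D(8)]) (use im in auto)
  have contd: "continuous_on {q..s} (\<lambda>t. x (\<sigma> (y t)) - x t)"
    by (intro continuous_intros continuous_on_compose2[OF D(7)[of UNIV] cont] D(7)) auto
  \<comment> \<open>At the top the abscissa moves with slope -1: arc points just before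
    \<open>q\<close> lie to its right, curve points just after \<open>q\<close> to its left.\<close>
  have dneg: "(x has_real_derivative -1) (at q)" using D(4)[of q] assms(4) by simp
  obtain d1 where d1: "d1 > 0" "\<And>h. h > 0 \<Longrightarrow> h < d1 \<Longrightarrow> x q < x (q - h)"
    using DERIV_neg_dec_left[OF dneg] by auto
  obtain d2 where d2: "d2 > 0" "\<And>h. h > 0 \<Longrightarrow> h < d2 \<Longrightarrow> x (q + h) < x q"
    using DERIV_neg_dec_right[OF dneg] by auto
  obtain e where e: "e > 0" "\<And>t. t \<in> {q..s} \<Longrightarrow> dist t q < e \<Longrightarrow> dist (\<sigma> (y t)) (\<sigma> (y q)) < d1"
    using cont[unfolded continuous_on_iff, rule_format, of q d1] d1(1) \<open>q < s\<close> by auto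
  \<comment> \<open>Halving keeps \<open>q + h\<close> before \<open>s\<close> and inside both
    neighbourhoods; by continuity its level arc point is so close to \<open>q\<close> that it is not
    left of it.\<close>
  define h where "h = min (s - q) (min d2 e) / 2"
  have h: "h > 0" "h < s - q" "h < d2" "h < e"
    using \<open>q < s\<close> d2(1) e(1) unfolding h_def by auto
  have "x q \<le> x (\<sigma> (y (q + h)))"
  proof -
    have "dist (\<sigma> (y (q + h))) q < d1" using e(2)[of "q + h"] h \<sigma>[of q] assms(2) by (simp add: dist_real_def)
    then show ?thesis
      using d1(2)[of "q - \<sigma> (y (q + h))"] \<sigma>_in(1)[of "q + h"] h
      by (cases "\<sigma> (y (q + h)) = q") (auto simp: dist_real_def)
  qed
  with d2(2)[of h] h have pos: "0 < x (\<sigma> (y (q + h))) - x (q + h)" by simp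
  have "x (\<sigma> (y s)) - x s \<le> 0"
    using neg \<sigma>[of u] assms(7-9) by simp
  \<comment> \<open>The difference of abscissas vanishes somewhere: two points of equal height and
    abscissa, hence equal parameters, although one is at most \<open>q\<close> and the other beyond
    it.\<close>
  then obtain t where t: "q + h \<le> t" "t \<le> s" "x (\<sigma> (y t)) - x t = 0"
    using IVT2'[of "\<lambda>t. x (\<sigma> (y t)) - x t" s 0 "q + h"] pos h
      continuous_on_subset[OF contd] by force
  then have "\<sigma> (y t) = t" using D(6)[of "\<sigma> (y t)" t] \<sigma>_in(2)[of t] h by simp
  moreover have "\<sigma> (y t) \<le> q" using \<sigma>_in(1)[of t] t h by simp
  ultimately show False using t(1) h(1) by linarith
qed

text \<open>The ascending case after a half turn, which exchanges left and right.\<close>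

lemma side_of_descending_arm:
  assumes "left_turning \<theta> x y" "p < q" "pi \<le> \<theta> p" "\<theta> q = 2 * pi"
    and path: "\<And>t. q < t \<Longrightarrow> t \<le> s \<Longrightarrow> y q \<le> y t \<and> y t \<le> y p"
    and "q < s" "p \<le> u" "u \<le> q" "y u = y s"
  shows "x u < x s"
proof -
  have "- x s < - x u"
  proof (rule side_of_ascending_arm[OF left_turning_half_turn[OF assms(1)] assms(2)])
    show "0 \<le> \<theta> p - pi" "\<theta> q - pi = pi" using assms(3,4) by simp_all
    show "- y p \<le> - y t \<and> - y t \<le> - y q" if "q < t" "t \<le> s" for t
      using path[OF that] by simp
    show "- y u = - y s" using assms(9) by simp
  qed fact+
  then show ?thesis by simp
qed

text \<open>The arc after \<open>p2\<close> has the descending arm on its left and the older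
  ascending arm on its right. The arms meet at \<open>p1\<close>, which leaves no room between them
  at that height.\<close>

lemma inward_half_turn:
  assumes "left_turning \<theta> x y" "p0 < p1" "p1 < p2" "0 \<le> \<theta> p0" "\<theta> p1 = pi" "\<theta> p2 = 2 * pi"
    and "y p0 \<le> y p2" "p2 < q" "\<theta> q \<le> 3 * pi"
  shows "y q < y p1" "\<exists>u\<in>{p0..p1}. \<exists>v\<in>{p1..p2}. y u = y q \<and> y v = y q \<and> x v < x q \<and> x q < x u"
proof -
  note D = left_turningD[OF assms(1)]
  have desc: "y t < y s" if "p1 \<le> s" "s < t" "t \<le> p2" for s t
    using left_turning_descend[OF assms(1) _ _ that] assms by simp
  have asc: "y s < y t" if "p2 \<le> s" "s < t" "t \<le> q" for s t
    using left_turning_descend[OF left_turning_half_turn[OF assms(1)] _ _ that] assms by simp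
  have between: "x v < x r \<and> x r < x u"
    if r: "p2 < r" "r \<le> q" "y r \<le> y p1" and u: "p0 \<le> u" "u \<le> p1" "y u = y r"
      and v: "p1 \<le> v" "v \<le> p2" "y v = y r" for r u v
  proof
    have late: "y p2 < y t \<and> y t \<le> y p1" if "p2 < t" "t \<le> r" for t
      using asc[of p2 t] asc[of t r] that r by (cases "t = r") auto
    show "x v < x r"
    proof (rule side_of_descending_arm[OF assms(1,3)])
      show "pi \<le> \<theta> p1" using assms(5) by simp
      show "y p2 \<le> y t \<and> y t \<le> y p1" if "p2 < t" "t \<le> r" for t
        using late[OF that] by simp
    qed fact+
    \<comment> \<open>Seen from the older arm, the path includes the descending arc;
      \<open>y p0 \<le> y p2\<close> keeps it above the foot of that arm.\<close>
    have path: "y p0 \<le> y t \<and> y t \<le> y p1" if "p1 < t" "t \<le> r" for t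
    proof (cases "t \<le> p2")
      case True
      then show ?thesis using desc[of p1 t] desc[of t p2] that assms(7) by (cases "t = p2") auto
    next
      case False
      then show ?thesis using late[of t] that assms(7) by auto
    qed
    show "x r < x u"
    proof (rule side_of_ascending_arm[OF assms(1,2,4,5)])
      show "p1 < r" using assms(3) r(1) by simp
    qed (fact path u)+
  qed
  have low: "y p2 < y p1" using desc[of p1 p2] assms by simp
  show less: "y q < y p1"
  proof (rule ccontr)
    assume "\<not> y q < y p1"
    then obtain r where r: "p2 \<le> r" "r \<le> q" "y r = y p1"
      using IVT'[of y p2 "y p1" q, OF _ _ _ D(8)] low assms(8) by auto
    then have "p2 < r" using low by (cases "r = p2") auto
    \<comment> \<open>With \<open>p1\<close> as level point on both arms, this gives
      \<open>x p1 < x r\<close> and \<open>x r < x p1\<close>.\<close>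
    then show False using between[OF _ r(2) _ _ _ r(3)[symmetric] _ _ r(3)[symmetric]] r(3) assms(2,3) by auto
  qed
  have "y p2 < y q" using asc[of p2 q] assms(8) by simp
  then obtain u v where "p0 \<le> u" "u \<le> p1" "y u = y q" "p1 \<le> v" "v \<le> p2" "y v = y q"
    using IVT'[of y p0 "y q" p1, OF _ _ _ D(8)] IVT2'[of y p2 "y q" p1, OF _ _ _ D(8)] less assms(2,3,7) by auto
  moreover from this have "x v < x q \<and> x q < x u"
    using between[of q u v] less assms(8) by simp
  moreover have "u \<in> {p0..p1}" "v \<in> {p1..p2}" using calculation by simp_all
  ultimately show "\<exists>u\<in>{p0..p1}. \<exists>v\<in>{p1..p2}. y u = y q \<and> y v = y q \<and> x v < x q \<and> x q < x u"
    by blast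
qed

text \<open>Induction on the number of half turns: each adds an arc inside the same box and hands a
  triple \<open>p1\<close>, \<open>p2\<close>, \<open>p3\<close> to the next, so \<open>B\<close>
  never grows.\<close>

lemma inward_spiral_in_box_aux:
  assumes "left_turning \<theta> x y" "p0 < p1" "p1 < p2" "0 \<le> \<theta> p0" "\<theta> p1 = pi" "\<theta> p2 = 2 * pi"
    and "y p0 \<le> y p2"
    and "\<And>t. p0 \<le> t \<Longrightarrow> t \<le> p2 \<Longrightarrow> \<bar>x t\<bar> \<le> B \<and> \<bar>y t\<bar> \<le> B"
    and "p0 \<le> s" "\<theta> s \<le> 2 * pi + real n * pi"
  shows "\<bar>x s\<bar> \<le> B \<and> \<bar>y s\<bar> \<le> B"
  using assms
proof (induction n arbitrary: \<theta> x y p0 p1 p2)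
  case 0
  then have "s \<le> p2" using left_turningD(2)[OF 0(1), of p2 s] by force
  then show ?case using 0 by simp
next
  case (Suc n)
  note D = left_turningD[OF Suc.prems(1)]
  note inward = inward_half_turn[OF Suc.prems(1-7)]
  have box: "\<bar>x t\<bar> \<le> B \<and> \<bar>y t\<bar> \<le> B" if "p0 \<le> t" "\<theta> t \<le> 3 * pi" for t
  proof (cases "t \<le> p2")
    case False
    then obtain u v where "u\<in>{p0..p1}" "v\<in>{p1..p2}" "y u = y t" "x v < x t" "x t < x u"
      using inward(2)[of t] \<open>\<theta> t \<le> 3 * pi\<close> by auto
    then show ?thesis
      using Suc.prems(8)[of u] Suc.prems(8)[of v] Suc.prems(2,3) by auto
  qed (use Suc.prems that in auto)
  show ?case
  proof (cases "\<theta> s \<le> 3 * pi")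
    case False
    then obtain p3 where p3: "p2 < p3" "p3 < s" "\<theta> p3 = 3 * pi"
      using left_turning_angle_ivt[OF Suc.prems(1), of p2 "3 * pi" s] Suc.prems(6) by auto
    \<comment> \<open>Upside down, \<open>p1\<close> and \<open>p3\<close> are minima and
      \<open>p2\<close> is the maximum; that \<open>p3\<close> is lower than \<open>p1\<close>
      becomes the inward condition.\<close>
    have "\<bar>- x s\<bar> \<le> B \<and> \<bar>- y s\<bar> \<le> B"
    proof (rule Suc.IH[OF left_turning_half_turn[OF Suc.prems(1)], of p1 p2 p3])
      show "- y p1 \<le> - y p3" using inward(1)[of p3] p3 by simp
      show "\<bar>- x t\<bar> \<le> B \<and> \<bar>- y t\<bar> \<le> B" if "p1 \<le> t" "t \<le> p3" for t
        using box[of t] that D(3)[of t p3] p3 Suc.prems(2) by auto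
    qed (use p3 Suc.prems in \<open>auto simp: algebra_simps\<close>)
    then show ?thesis by simp
  qed (use box Suc.prems in auto)
qed

text \<open>Compactness boxes in the first two arcs, and every later angle is reached after finitely
  many half turns within the same box.\<close>

lemma inward_spiral_bounded:
  assumes "left_turning \<theta> x y" "p0 < p1" "p1 < p2" "0 \<le> \<theta> p0" "\<theta> p1 = pi" "\<theta> p2 = 2 * pi"
    and "y p0 \<le> y p2"
  shows "\<exists>B. \<forall>s\<ge>p0. \<bar>x s\<bar> \<le> B \<and> \<bar>y s\<bar> \<le> B"
proof -
  note D = left_turningD[OF assms(1)]
  obtain B1 where B1: "\<And>t. t \<in> {p0..p2} \<Longrightarrow> \<bar>x t\<bar> \<le> B1"
    using compact_imp_bounded[OF compact_continuous_image[OF D(7)[of "{p0..p2}"] compact_Icc]]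
    unfolding bounded_iff by (metis imageI real_norm_def)
  obtain B2 where B2: "\<And>t. t \<in> {p0..p2} \<Longrightarrow> \<bar>y t\<bar> \<le> B2"
    using compact_imp_bounded[OF compact_continuous_image[OF D(8)[of "{p0..p2}"] compact_Icc]]
    unfolding bounded_iff by (metis imageI real_norm_def)
  have "\<bar>x s\<bar> \<le> max B1 B2 \<and> \<bar>y s\<bar> \<le> max B1 B2" if "p0 \<le> s" for s
  proof -
    obtain n where "\<theta> s < real n * pi" using reals_Archimedean3[of pi] by auto
    then have "\<theta> s \<le> 2 * pi + real n * pi" using pi_gt_zero by linarith
    moreover have "\<bar>x t\<bar> \<le> max B1 B2 \<and> \<bar>y t\<bar> \<le> max B1 B2" if "p0 \<le> t" "t \<le> p2" for t
      using B1[of t] B2[of t] that by auto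
    ultimately show ?thesis
      using inward_spiral_in_box_aux[OF assms] \<open>p0 \<le> s\<close> by blast
  qed
  then show ?thesis by blast
qed

section \<open>Total turning\<close>

text \<open>The inverse rotation has entries of absolute value at most 1. Boundedness in rotated
  coordinates thus carries back to the original ones.\<close>

lemma rotation_abs_bound:
  fixes a b c :: real
  shows "\<bar>a\<bar> + \<bar>b\<bar> \<le> 2 * (\<bar>cos c * a - sin c * b\<bar> + \<bar>sin c * a + cos c * b\<bar>)"
proof -
  define A B where "A = cos c * a - sin c * b" and "B = sin c * a + cos c * b"
  have split: "((cos c)\<^sup>2 + (sin c)\<^sup>2) * d = d" for d by simp
  have a: "a = cos c * A + sin c * B" and b: "b = cos c * B - sin c * A"
    using split[of a] split[of b] unfolding A_def B_def
    by (simp_all only: power2_eq_square distrib_right distrib_left right_diff_distrib mult.assoc mult.left_commute)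
  have "\<bar>cos c * A\<bar> \<le> \<bar>A\<bar>" "\<bar>sin c * B\<bar> \<le> \<bar>B\<bar>" "\<bar>cos c * B\<bar> \<le> \<bar>B\<bar>" "\<bar>sin c * A\<bar> \<le> \<bar>A\<bar>"
    by (simp_all add: abs_mult mult_left_le_one_le)
  then have "\<bar>a\<bar> \<le> \<bar>A\<bar> + \<bar>B\<bar>" "\<bar>b\<bar> \<le> \<bar>A\<bar> + \<bar>B\<bar>"
    unfolding a b by linarith+
  from add_mono[OF this] show ?thesis unfolding A_def[symmetric] B_def[symmetric] by (simp only: mult_2)
qed

text \<open>The hypotheses make the curve unbounded on every forward and backward half-line. After a
  full turn, comparing the heights of the two minima shows that it is trapped forwards or
  backwards.\<close>

lemma no_full_turn:
  assumes "left_turning \<theta> x y"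
    and fwd: "\<And>a B. \<exists>s\<ge>a. B < \<bar>x s\<bar> + \<bar>y s\<bar>"
    and bwd: "\<And>a B. \<exists>s\<le>a. B < \<bar>x s\<bar> + \<bar>y s\<bar>"
  shows "\<theta> t - \<theta> s < 2 * pi"
proof (rule ccontr)
  assume turn: "\<not> \<theta> t - \<theta> s < 2 * pi"
  note D = left_turningD[OF assms(1)]
  have "s < t" using D(3)[of t s] turn pi_gt_zero by argo
  define c where "c = - \<theta> s"
  define X where "X = (\<lambda>r. cos c * x r - sin c * y r)"
  define Y where "Y = (\<lambda>r. sin c * x r + cos c * y r)"
  have rot: "left_turning (\<lambda>r. \<theta> r + c) X Y"
    unfolding X_def Y_def by (rule left_turning_rotate[OF assms(1)])
  obtain p2 where p2: "s \<le> p2" "\<theta> p2 + c = 2 * pi"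
    using IVT'[of "\<lambda>r. \<theta> r + c" s "2 * pi" t] turn \<open>s < t\<close> left_turningD(1)[OF rot] pi_gt_zero
    unfolding c_def by force
  obtain p1 where p1: "s < p1" "p1 < p2" "\<theta> p1 + c = pi"
    using left_turning_angle_ivt[OF rot, of s pi p2] p2 unfolding c_def by auto
  have bound: "\<bar>x r\<bar> + \<bar>y r\<bar> \<le> 4 * B" if "\<bar>X r\<bar> \<le> B \<and> \<bar>Y r\<bar> \<le> B" for r B
  proof -
    have "\<bar>x r\<bar> + \<bar>y r\<bar> \<le> 2 * (\<bar>X r\<bar> + \<bar>Y r\<bar>)"
      unfolding X_def Y_def by (rule rotation_abs_bound)
    also have "\<dots> \<le> 4 * B" using add_mono[OF conjunct1[OF that] conjunct2[OF that]] by simp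
    finally show ?thesis .
  qed
  show False
  proof (cases "Y s \<le> Y p2")
    case True
    then obtain B where "\<And>r. s \<le> r \<Longrightarrow> \<bar>X r\<bar> \<le> B \<and> \<bar>Y r\<bar> \<le> B"
      using inward_spiral_bounded[OF rot p1(1,2) _ p1(3) p2(2)] unfolding c_def by auto
    then show False using fwd[of s "4 * B"] bound by force
  next
    case False
    \<comment> \<open>Reversal orders the points as \<open>- p2\<close>, \<open>- p1\<close>,
      \<open>- s\<close>; adding \<open>2 * pi\<close> gives them the angles \<open>0\<close>,
      \<open>pi\<close>, \<open>2 * pi\<close>.\<close>
    have "left_turning (\<lambda>r. - (\<theta> (- r) + c) + 2 * pi) (\<lambda>r. - X (- r)) (\<lambda>r. Y (- r))"
      using left_turning_rotate[OF left_turning_reverse[OF rot], of "2 * pi"] by simp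
    then have "\<exists>B. \<forall>r\<ge>- p2. \<bar>- X (- r)\<bar> \<le> B \<and> \<bar>Y (- r)\<bar> \<le> B"
      by (rule inward_spiral_bounded[of _ _ _ _ "- p1" "- s"]) (use p1 p2 False c_def in auto)
    then obtain B where "\<And>r. - p2 \<le> r \<Longrightarrow> \<bar>- X (- r)\<bar> \<le> B \<and> \<bar>Y (- r)\<bar> \<le> B"
      by blast
    from this[of "- r" for r] have "\<bar>X r\<bar> \<le> B \<and> \<bar>Y r\<bar> \<le> B" if "r \<le> p2" for r
      using that by simp
    then show False using bwd[of p2 "4 * B"] bound by force
  qed
qed

lemma eventually_below_of_deriv_neg:
  fixes f f' :: "real \<Rightarrow> real"
  assumes deriv: "\<And>s. a \<le> s \<Longrightarrow> (f has_real_derivative f' s) (at s)"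
    and neg: "\<And>s. a \<le> s \<Longrightarrow> f' s \<le> k" "k < 0"
  shows "\<exists>s\<ge>a. f s \<le> M"
proof -
  \<comment> \<open>The line through \<open>(a, f a)\<close> with slope \<open>k\<close> bounds
    \<open>f\<close>; \<open>s\<close> is where it reaches \<open>M\<close>, or \<open>a\<close>
    itself if \<open>f a\<close> is already at most \<open>M\<close>.\<close>
  define s where "s = a + max 0 ((M - f a) / k)"
  have "a \<le> s" unfolding s_def by simp
  have "f s - k * s \<le> f a - k * a"
  proof (rule DERIV_nonpos_imp_nonincreasing[OF \<open>a \<le> s\<close>])
    fix z assume "a \<le> z"
    then have "((\<lambda>s. f s - k * s) has_real_derivative f' z - k) (at z)"
      using DERIV_diff[OF deriv[of z] DERIV_cmult[OF DERIV_ident, of k]] by simp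
    moreover have "f' z - k \<le> 0" using neg(1)[OF \<open>a \<le> z\<close>] by simp
    ultimately show "\<exists>w. ((\<lambda>s. f s - k * s) has_real_derivative w) (at z) \<and> w \<le> 0" by blast
  qed
  then have "f s \<le> f a + k * (s - a)" by (simp add: right_diff_distrib)
  moreover have "k * (s - a) \<le> k * ((M - f a) / k)"
    using neg(2) unfolding s_def by (intro mult_left_mono_neg) auto
  ultimately have "f s \<le> M" using neg(2) by simp
  then show ?thesis using \<open>a \<le> s\<close> by blast
qed

theorem total_turning_le_pi:
  assumes "left_turning \<theta> x y"
    and fwd: "\<And>a B. \<exists>s\<ge>a. B < \<bar>x s\<bar> + \<bar>y s\<bar>"
    and bwd: "\<And>a B. \<exists>s\<le>a. B < \<bar>x s\<bar> + \<bar>y s\<bar>"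
  shows "\<theta> t - \<theta> s \<le> pi"
proof (rule ccontr)
  assume turn: "\<not> \<theta> t - \<theta> s \<le> pi"
  note D = left_turningD[OF assms(1)]
  note small = no_full_turn[OF assms]
  define \<alpha> \<beta> where "\<alpha> = Inf (range \<theta>)" and "\<beta> = Sup (range \<theta>)"
  have bdd: "bdd_below (range \<theta>)" "bdd_above (range \<theta>)"
    by (rule bdd_belowI2[of _ "\<theta> 0 - 2 * pi"], use small[of 0] in \<open>simp add: less_imp_le algebra_simps\<close>)
      (rule bdd_aboveI2[of _ _ "\<theta> 0 + 2 * pi"], use small[of _ 0] in \<open>simp add: less_imp_le algebra_simps\<close>)
  have \<alpha>: "\<alpha> \<le> \<theta> r" and \<beta>: "\<theta> r \<le> \<beta>" for r
    unfolding \<alpha>_def \<beta>_def using bdd by (auto intro: cInf_lower cSup_upper)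
  have "\<theta> r - 2 * pi \<le> \<alpha>" for r
    unfolding \<alpha>_def using small[of r] by (intro cInf_greatest) (auto simp: less_imp_le algebra_simps)
  then have "\<beta> \<le> \<alpha> + 2 * pi"
    unfolding \<beta>_def by (intro cSup_least) (auto simp: algebra_simps)
  have "pi < \<beta> - \<alpha>" using turn \<alpha>[of s] \<beta>[of t] by linarith
  \<comment> \<open>The range has width above \<open>pi\<close> and at most \<open>2 * pi\<close>;
    centred at \<open>pi / 2\<close>, it lies between \<open>- (pi / 2)\<close> and
    \<open>3 * pi / 2\<close> and extends beyond both \<open>0\<close> and
    \<open>pi\<close>.\<close>
  define c where "c = pi / 2 - (\<alpha> + \<beta>) / 2"
  define \<psi> where "\<psi> = (\<lambda>r. \<theta> r + c)"
  define X where "X = (\<lambda>r. cos c * x r - sin c * y r)"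
  define Y where "Y = (\<lambda>r. sin c * x r + cos c * y r)"
  have rot: "left_turning \<psi> X Y"
    unfolding X_def Y_def \<psi>_def by (rule left_turning_rotate[OF assms(1)])
  note R = left_turningD[OF rot]
  have range: "- (pi / 2) \<le> \<psi> r" "\<psi> r \<le> 3 * pi / 2" for r
    using \<alpha>[of r] \<beta>[of r] \<open>\<beta> \<le> \<alpha> + 2 * pi\<close> unfolding \<psi>_def c_def by argo+
  have "\<alpha> < - c" "pi - c < \<beta>" using \<open>pi < \<beta> - \<alpha>\<close> unfolding c_def by argo+
  then obtain r0 r1 where "\<theta> r0 < - c" "pi - c < \<theta> r1"
    using cInf_lessD[of "range \<theta>" "- c"] less_cSupD[of "range \<theta>" "pi - c"]
    unfolding \<alpha>_def \<beta>_def by blast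
  then have r: "\<psi> r0 < 0" "pi < \<psi> r1" unfolding \<psi>_def by linarith+
  then obtain b where b: "\<psi> b = pi"
    using left_turning_angle_ivt[OF rot, of r0 pi r1] pi_gt_zero by force
  then obtain a where a: "\<psi> a = 0" "a < b"
    using left_turning_angle_ivt[OF rot, of r0 0 b] r pi_gt_zero by force
  \<comment> \<open>The slope of the height is zero at \<open>b\<close>, hence the shift by 1. From
    \<open>b + 1\<close> on, \<open>\<psi>\<close> stays above \<open>pi\<close> and at most
    \<open>3 * pi / 2\<close>, where the sine decreases, so the slope is at most a negative
    constant.\<close>
  have "\<exists>q\<ge>b + 1. Y q \<le> Y a"
  proof (rule eventually_below_of_deriv_neg[OF R(5)])
    have b1: "pi < \<psi> (b + 1)" using R(2)[of b "b + 1"] b by simp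
    then show "sin (\<psi> (b + 1)) < 0"
      using sin_lt_zero[of "\<psi> (b + 1)"] range(2)[of "b + 1"] pi_gt_zero by argo
    fix q assume "b + 1 \<le> q"
    then have "sin (\<psi> (b + 1) - pi) \<le> sin (\<psi> q - pi)"
      using R(3)[of "b + 1" q] b1 range(2)[of q] pi_gt_zero by (intro sin_monotone_2pi_le) argo+
    then show "sin (\<psi> q) \<le> sin (\<psi> (b + 1))" by simp
  qed
  then obtain q where q: "b + 1 \<le> q" "Y q \<le> Y a" by blast
  \<comment> \<open>The same backwards in time from \<open>a - 1\<close>, for \<open>- Y\<close> and
    with \<open>l\<close> as reversed time.\<close>
  have "\<exists>l\<ge>- (a - 1). - Y (- l) \<le> - Y b"
  proof (rule eventually_below_of_deriv_neg)
    show "((\<lambda>l. - Y (- l)) has_real_derivative sin (\<psi> (- l))) (at l)" for l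
      using DERIV_minus[OF DERIV_chain2[OF R(5)[of "- l"] DERIV_minus[OF DERIV_ident]]] by simp
    have a1: "\<psi> (a - 1) < 0" using R(2)[of "a - 1" a] a by simp
    then show "sin (\<psi> (a - 1)) < 0"
      using sin_gt_zero[of "- \<psi> (a - 1)"] range(1)[of "a - 1"] pi_gt_zero by simp
    fix l assume "- (a - 1) \<le> l"
    then show "sin (\<psi> (- l)) \<le> sin (\<psi> (a - 1))"
      using R(3)[of "- l" "a - 1"] a1 range(1)[of "- l"] pi_gt_zero by (intro sin_monotone_2pi_le) argo+
  qed
  then obtain l where l: "1 - a \<le> l" "Y b \<le> Y (- l)" by auto
  \<comment> \<open>After a half turn \<open>a\<close> is a maximum and \<open>b\<close> a minimum,
    and \<open>- l\<close> starts the older arm. Trapping then puts \<open>Y q\<close> above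
    \<open>Y a\<close>, contrary to the choice of \<open>q\<close>.\<close>
  have flip: "left_turning (\<lambda>s. \<psi> s + pi) (\<lambda>s. - X s) (\<lambda>s. - Y s)"
    using left_turning_rotate[OF rot, of pi] by simp
  have "- Y q < - Y a"
  proof (rule inward_half_turn(1)[OF flip])
    show "- l < a" "a < b" "b < q" "- Y (- l) \<le> - Y b" using l q a by simp_all
    show "0 \<le> \<psi> (- l) + pi" "\<psi> a + pi = pi" "\<psi> b + pi = 2 * pi" "\<psi> q + pi \<le> 3 * pi"
      using range(1)[of "- l"] range(2)[of q] a b pi_gt_zero by argo+
  qed
  then show False using q by simp
qed

section \<open>The tangent angle of a planar curve\<close>

text \<open>With the sign as a factor \<open>\<sigma>\<close>, later proofs reflect a coordinate
  instead of treating two cases.\<close>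

lemma nonvanishing_constant_sign:
  fixes f :: "real \<Rightarrow> real"
  assumes "continuous_on I f" "connected I" "\<And>s. s \<in> I \<Longrightarrow> f s \<noteq> 0"
  obtains \<sigma> where "\<sigma> = 1 \<or> \<sigma> = -1" "\<And>s. s \<in> I \<Longrightarrow> 0 < \<sigma> * f s"
proof (cases "\<exists>s\<in>I. f s < 0")
  case True
  then obtain s where s: "s \<in> I" "f s < 0" by blast
  have "0 < -1 * f t" if "t \<in> I" for t
  proof (rule ccontr)
    assume "\<not> 0 < -1 * f t"
    then have "0 \<in> f ` I"
      using connectedD_interval[OF connected_continuous_image[OF assms(1,2)], of "f s" "f t" 0] s that
      by simp
    then show False using assms(3) by auto
  qed
  then show ?thesis using that[of "-1"] by simp
next
  case False
  then have "0 < 1 * f t" if "t \<in> I" for t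
    using assms(3)[OF that] that by force
  then show ?thesis using that[of 1] by simp
qed

lemma planar_curveD:
  assumes "planar_curve I C" "s \<in> I"
  shows "(iter_deriv n C has_vector_derivative iter_deriv (Suc n) C s) (at s)"
    "isCont (iter_deriv n C) s" "norm (iter_deriv 1 C s) = 1"
proof -
  have "iter_deriv n C differentiable (at s)" for n
    using assms unfolding planar_curve_def by blast
  then show "(iter_deriv n C has_vector_derivative iter_deriv (Suc n) C s) (at s)"
    and "isCont (iter_deriv n C) s"
    by (simp_all add: iter_deriv_def flip: vector_derivative_works differentiable_imp_continuous_within)
      (simp add: differentiable_imp_continuous_within)
  show "norm (iter_deriv 1 C s) = 1"
    using assms unfolding planar_curve_def by blast
qed

lemma has_real_derivative_inner_right:
  fixes f :: "real \<Rightarrow> 'a::real_inner"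
  assumes "(f has_vector_derivative D) F"
  shows "((\<lambda>s. m \<bullet> f s) has_real_derivative m \<bullet> D) F"
  unfolding has_real_derivative_iff_has_vector_derivative
  by (rule bounded_linear.has_vector_derivative[OF bounded_linear_inner_right assms])

text \<open>\<open>(a, b)\<close> is a unit vector rotating with angular speed \<open>k\<close>. An
  antiderivative of \<open>k\<close> with matching initial value is its angle, since the vector is
  constant in the frame turning by that angle.\<close>

lemma angle_function_exists:
  fixes a b k :: "real \<Rightarrow> real"
  assumes a: "\<And>s. (a has_real_derivative - (k s * b s)) (at s)"
    and b: "\<And>s. (b has_real_derivative k s * a s) (at s)"
    and k: "\<And>s. isCont k s"
    and "(a 0)\<^sup>2 + (b 0)\<^sup>2 = 1"
  obtains \<theta> where "\<And>s. (\<theta> has_real_derivative k s) (at s)" "\<And>s. a s = cos (\<theta> s)" "\<And>s. b s = sin (\<theta> s)"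
proof -
  obtain K where K: "\<And>s. (K has_real_derivative k s) (at s)"
    using einterval_antiderivative[of "-\<infinity>" "\<infinity>" k] k
    by (auto simp: has_real_derivative_iff_has_vector_derivative)
  obtain \<theta>0 where \<theta>0: "a 0 = cos \<theta>0" "b 0 = sin \<theta>0"
    using sincos_total_2pi[OF assms(4)] by blast
  define \<theta> where "\<theta> s = K s + (\<theta>0 - K 0)" for s
  have \<theta>: "(\<theta> has_real_derivative k s) (at s)" for s
    unfolding \<theta>_def using DERIV_add[OF K[of s] DERIV_const[of "\<theta>0 - K 0"]] by simp
  \<comment> \<open>\<open>A\<close> and \<open>B\<close> are the coordinates of
    \<open>(a, b)\<close> in the turning frame; they have derivative zero and start at
    \<open>1\<close> and \<open>0\<close>.\<close>
  define A where "A s = a s * cos (\<theta> s) + b s * sin (\<theta> s)" for s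
  define B where "B s = b s * cos (\<theta> s) - a s * sin (\<theta> s)" for s
  note dcos = DERIV_chain2[OF DERIV_cos \<theta>] and dsin = DERIV_chain2[OF DERIV_sin \<theta>]
  have "(A has_real_derivative 0) (at s)" for s
    unfolding A_def
    using DERIV_add[OF DERIV_mult'[OF a[of s] dcos[of s]] DERIV_mult'[OF b[of s] dsin[of s]]]
    by (simp add: algebra_simps)
  then have "A s = A 0" for s using DERIV_isconst_all[of A s 0] by blast
  moreover have "(B has_real_derivative 0) (at s)" for s
    unfolding B_def
    using DERIV_diff[OF DERIV_mult'[OF b[of s] dcos[of s]] DERIV_mult'[OF a[of s] dsin[of s]]]
    by (simp add: algebra_simps)
  then have "B s = B 0" for s using DERIV_isconst_all[of B s 0] by blast
  moreover have "A 0 = 1" "B 0 = 0"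
    unfolding A_def B_def \<theta>_def using \<theta>0 by (simp_all flip: power2_eq_square)
  ultimately have AB: "A s = 1" "B s = 0" for s by simp_all
  have split: "d = ((cos (\<theta> s))\<^sup>2 + (sin (\<theta> s))\<^sup>2) * d" for s d
    by (simp only: sin_cos_squared_add2 mult_1)
  have "a s = cos (\<theta> s) * A s - sin (\<theta> s) * B s" for s
    by (subst split[of "a s" s], simp only: A_def B_def power2_eq_square distrib_left distrib_right
        right_diff_distrib mult.assoc mult.commute mult.left_commute)
  moreover have "b s = sin (\<theta> s) * A s + cos (\<theta> s) * B s" for s
    by (subst split[of "b s" s], simp only: A_def B_def power2_eq_square distrib_left distrib_right
        right_diff_distrib mult.assoc mult.commute mult.left_commute)
  ultimately show thesis using that[OF \<theta>] AB by simp
qed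

text \<open>The signed curvature is continuous and nowhere zero, so reflecting the second coordinate
  if necessary makes it positive. The norm bound passes escape to infinity on to the
  coordinates.\<close>

lemma planar_curve_left_turning:
  assumes curve: "planar_curve UNIV C" and pos: "\<And>s. 0 < curvature C s" and inj: "inj C"
  obtains \<theta> x y where "left_turning \<theta> x y" "\<And>s. (\<theta> has_real_derivative curvature C s) (at s)"
    "\<And>s. norm (C s) \<le> \<bar>x s\<bar> + \<bar>y s\<bar>"
proof -
  define T where "T = iter_deriv 1 C"
  define K where "K = iter_deriv 2 C"
  have normT: "norm (T s) = 1" for s
    unfolding T_def using planar_curveD(3)[OF curve] by blast
  have C: "(C has_vector_derivative T s) (at s)" and T: "(T has_vector_derivative K s) (at s)" for s
    using planar_curveD(1)[OF curve, of s 0] planar_curveD(1)[OF curve, of s 1]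
    unfolding T_def K_def by (simp_all add: iter_deriv_def numeral_2_eq_2)
  have K_deriv: "(K has_vector_derivative iter_deriv 3 C s) (at s)" for s
    using planar_curveD(1)[OF curve, of s 2] unfolding K_def by simp
  have comp: "((\<lambda>s. f s $ i) has_real_derivative D $ i) (at s)"
    if "(f has_vector_derivative D) (at s)" for f :: "real \<Rightarrow> real^2" and D s i
    unfolding has_real_derivative_iff_has_vector_derivative
    by (rule bounded_linear.has_vector_derivative[OF bounded_linear_vec_nth that])
  have unit: "T s $ 1 * T s $ 1 + T s $ 2 * T s $ 2 = 1" for s
    using normT[of s] by (simp add: norm_eq_1 inner_vec_def sum_2)
  have orth: "T s $ 1 * K s $ 1 + T s $ 2 * K s $ 2 = 0" for s
  proof -
    have "((\<lambda>s. T s $ 1 * T s $ 1 + T s $ 2 * T s $ 2) has_real_derivative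
        (T s $ 1 * K s $ 1 + K s $ 1 * T s $ 1) + (T s $ 2 * K s $ 2 + K s $ 2 * T s $ 2)) (at s)"
      by (intro DERIV_add DERIV_mult' comp T)
    then have "(T s $ 1 * K s $ 1 + K s $ 1 * T s $ 1) + (T s $ 2 * K s $ 2 + K s $ 2 * T s $ 2) = 0"
      unfolding unit using DERIV_unique[OF _ DERIV_const] by blast
    then show ?thesis by (simp add: mult.commute)
  qed
  \<comment> \<open>The signed curvature, a determinant. Since \<open>T s\<close> is a unit vector
    orthogonal to \<open>K s\<close>, the latter is \<open>k s\<close> times the quarter turn of
    \<open>T s\<close>.\<close>
  define k where "k s = T s $ 1 * K s $ 2 - T s $ 2 * K s $ 1" for s
  have K: "K s $ 1 = - (k s * T s $ 2)" "K s $ 2 = k s * T s $ 1" for s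
  proof -
    have "K s $ 1 = (T s $ 1 * T s $ 1 + T s $ 2 * T s $ 2) * K s $ 1"
      "K s $ 2 = (T s $ 1 * T s $ 1 + T s $ 2 * T s $ 2) * K s $ 2"
      by (simp_all add: unit)
    moreover have "T s $ 1 * (T s $ 1 * K s $ 1 + T s $ 2 * K s $ 2) = 0"
      "T s $ 2 * (T s $ 1 * K s $ 1 + T s $ 2 * K s $ 2) = 0" by (simp_all add: orth)
    ultimately show "K s $ 1 = - (k s * T s $ 2)" "K s $ 2 = k s * T s $ 1"
      unfolding k_def by argo+
  qed
  have abs_k: "\<bar>k s\<bar> = curvature C s" for s
  proof -
    have "(norm (K s))\<^sup>2 = (k s)\<^sup>2 * (T s $ 1 * T s $ 1 + T s $ 2 * T s $ 2)"
      unfolding power2_norm_eq_inner inner_vec_def sum_2 K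
      by (simp add: power2_eq_square distrib_left mult.assoc mult.left_commute)
    then have "sqrt ((norm (K s))\<^sup>2) = sqrt ((k s)\<^sup>2)" unfolding unit by (simp only: mult_1_right)
    then show ?thesis unfolding curvature_def K_def by simp
  qed
  have cont_k: "isCont k s" for s
    unfolding k_def
    by (intro continuous_diff isCont_mult DERIV_isCont[OF comp[OF T]] DERIV_isCont[OF comp[OF K_deriv]])
  obtain \<sigma> :: real where \<sigma>: "\<sigma> = 1 \<or> \<sigma> = -1" "\<And>s. 0 < \<sigma> * k s"
    using nonvanishing_constant_sign[of UNIV k] cont_k pos abs_k
    by (metis UNIV_I abs_zero connected_UNIV continuous_at_imp_continuous_on less_irrefl)
  have \<sigma>k: "\<sigma> * k s = curvature C s" for s
    using \<sigma>(2)[of s] \<sigma>(1) abs_k[of s] by auto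
  have \<sigma>\<sigma>: "\<sigma> * (\<sigma> * d) = d" for d using \<sigma>(1) by auto
  obtain \<theta> where \<theta>: "\<And>s. (\<theta> has_real_derivative \<sigma> * k s) (at s)" "\<And>s. T s $ 1 = cos (\<theta> s)"
    "\<And>s. \<sigma> * T s $ 2 = sin (\<theta> s)"
  proof (rule angle_function_exists)
    show "((\<lambda>s. T s $ 1) has_real_derivative - (\<sigma> * k s * (\<sigma> * T s $ 2))) (at s)" for s
      using comp[OF T, of 1 s] unfolding K by (simp add: mult.assoc mult.left_commute[of "k s" \<sigma>] \<sigma>\<sigma>)
    show "((\<lambda>s. \<sigma> * T s $ 2) has_real_derivative \<sigma> * k s * T s $ 1) (at s)" for s
      using DERIV_cmult[OF comp[OF T, of 2 s], of \<sigma>] unfolding K by (simp add: mult.assoc)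
    show "isCont (\<lambda>s. \<sigma> * k s) s" for s using cont_k by (intro isCont_mult) auto
    show "(T 0 $ 1)\<^sup>2 + (\<sigma> * T 0 $ 2)\<^sup>2 = 1"
      using unit[of 0] \<sigma>(1) by (auto simp: power2_eq_square)
  qed blast
  have turning: "left_turning \<theta> (\<lambda>s. C s $ 1) (\<lambda>s. \<sigma> * C s $ 2)"
    unfolding left_turning_def
  proof (intro conjI allI)
    show "continuous_on UNIV \<theta>" by (rule DERIV_continuous_on[OF \<theta>(1)])
    show "strict_mono \<theta>"
      by (rule strict_monoI, rule DERIV_pos_imp_increasing[where f = \<theta>]) (use \<theta>(1) \<sigma>(2) in blast)+
    show "((\<lambda>s. C s $ 1) has_real_derivative cos (\<theta> s)) (at s)" for s
      using comp[OF C, of 1 s] unfolding \<theta>(2) .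
    show "((\<lambda>s. \<sigma> * C s $ 2) has_real_derivative sin (\<theta> s)) (at s)" for s
      using DERIV_cmult[OF comp[OF C, of 2 s], of \<sigma>] unfolding \<theta>(3) .
    show "inj (\<lambda>s. (C s $ 1, \<sigma> * C s $ 2))"
    proof (rule injI)
      fix s t assume "(C s $ 1, \<sigma> * C s $ 2) = (C t $ 1, \<sigma> * C t $ 2)"
      then have "C s = C t" using \<sigma>(1) unfolding vec_eq_iff forall_2 by auto
      then show "s = t" using inj by (simp add: inj_eq)
    qed
  qed
  have "norm (C s) \<le> \<bar>C s $ 1\<bar> + \<bar>\<sigma> * C s $ 2\<bar>" for s
  proof -
    have "\<bar>\<sigma> * C s $ 2\<bar> = \<bar>C s $ 2\<bar>" using \<sigma>(1) by auto
    then show ?thesis using norm_le_l1_cart[of "C s"] by (simp add: sum_2)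
  qed
  then show thesis using that[OF turning] \<theta>(1) \<sigma>k by simp
qed

text \<open>Closedness makes the part of the image in a ball compact, and the continuous inverse
  sends it to a bounded set of parameters.\<close>

lemma closed_embedded_curve_escapes:
  assumes "embedded_curve I C" "closed (C ` I)"
  shows "bounded {s \<in> I. norm (C s) \<le> B}"
proof -
  obtain g where g: "homeomorphism I (C ` I) C g"
    using assms(1) unfolding embedded_curve_def by blast
  define Q where "Q = C ` I \<inter> cball 0 B"
  have "compact Q" unfolding Q_def using assms(2) by (intro closed_Int_compact compact_cball)
  moreover have "continuous_on Q g"
    using homeomorphism_cont2[OF g] continuous_on_subset unfolding Q_def by blast
  ultimately have "bounded (g ` Q)" by (intro compact_imp_bounded compact_continuous_image)
  moreover have "{s \<in> I. norm (C s) \<le> B} \<subseteq> g ` Q"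
  proof
    fix s assume "s \<in> {s \<in> I. norm (C s) \<le> B}"
    then have "C s \<in> Q" "g (C s) = s"
      using homeomorphism_apply1[OF g] unfolding Q_def by simp_all
    then show "s \<in> g ` Q" by force
  qed
  ultimately show ?thesis by (rule bounded_subset)
qed

theorem closed_embedded_curve_turning_le_pi:
  assumes curve: "complete_closed_embedded UNIV C" and pos: "\<And>s. 0 < curvature C s"
  obtains \<theta> where "\<And>s. (\<theta> has_real_derivative curvature C s) (at s)" "\<And>s t. \<theta> t - \<theta> s \<le> pi"
proof -
  have emb: "embedded_curve UNIV C" and cl: "closed (range C)" and planar: "planar_curve UNIV C"
    using curve unfolding complete_closed_embedded_def complete_curve_def by blast+
  obtain g where "homeomorphism UNIV (range C) C g"
    using emb unfolding embedded_curve_def by blast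
  then have "inj C" by (rule inj_on_inverseI[OF homeomorphism_apply1])
  then obtain \<theta> x y where lt: "left_turning \<theta> x y" and \<theta>: "\<And>s. (\<theta> has_real_derivative curvature C s) (at s)"
    and norm: "\<And>s. norm (C s) \<le> \<bar>x s\<bar> + \<bar>y s\<bar>"
    using planar_curve_left_turning[OF planar pos] by blast
  have far: "\<exists>R. \<forall>s. \<bar>x s\<bar> + \<bar>y s\<bar> \<le> B \<longrightarrow> \<bar>s\<bar> \<le> R" for B
  proof -
    obtain R where "\<And>s. norm (C s) \<le> B \<Longrightarrow> \<bar>s\<bar> \<le> R"
      using closed_embedded_curve_escapes[OF emb cl, of B] unfolding bounded_iff by auto
    then show ?thesis using norm order_trans by blast
  qed
  have "\<exists>s\<ge>a. B < \<bar>x s\<bar> + \<bar>y s\<bar>" "\<exists>s\<le>a. B < \<bar>x s\<bar> + \<bar>y s\<bar>" for a B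
  proof -
    obtain R where R: "\<And>s. \<bar>x s\<bar> + \<bar>y s\<bar> \<le> B \<Longrightarrow> \<bar>s\<bar> \<le> R" using far by blast
    show "\<exists>s\<ge>a. B < \<bar>x s\<bar> + \<bar>y s\<bar>"
      using R[of "max a (R + 1)"] by (intro exI[of _ "max a (R + 1)"]) (smt (verit))
    show "\<exists>s\<le>a. B < \<bar>x s\<bar> + \<bar>y s\<bar>"
      using R[of "min a (- R - 1)"] by (intro exI[of _ "min a (- R - 1)"]) (smt (verit))
  qed
  then show thesis using that[OF \<theta>] total_turning_le_pi[OF lt] by blast
qed

section \<open>Parabolas\<close>

text \<open>The foot of the perpendicular attains the value; Cauchy-Schwarz bounds all other
  distances from below.\<close>

lemma infdist_hyperplane:
  fixes n :: "'a::euclidean_space"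
  assumes "norm n = 1"
  shows "infdist x {z. n \<bullet> z = c} = \<bar>n \<bullet> x - c\<bar>"
proof (rule antisym)
  let ?L = "{z. n \<bullet> z = c}" and ?z = "x - (n \<bullet> x - c) *\<^sub>R n"
  have nn: "n \<bullet> n = 1" using assms by (simp add: norm_eq_1)
  have z: "?z \<in> ?L" by (simp add: inner_diff_right nn)
  have "dist x ?z = \<bar>n \<bullet> x - c\<bar>" using assms by (simp add: dist_norm)
  then show "infdist x ?L \<le> \<bar>n \<bullet> x - c\<bar>" using infdist_le[OF z, of x] by (simp only:)
  have "\<bar>n \<bullet> x - c\<bar> \<le> dist x z" if "z \<in> ?L" for z
    using Cauchy_Schwarz_ineq2[of n "x - z"] that assms by (simp add: inner_diff_right dist_norm)
  then have "\<bar>n \<bullet> x - c\<bar> \<le> (INF z\<in>?L. dist x z)"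
    using z by (intro cINF_greatest) blast+
  then show "\<bar>n \<bullet> x - c\<bar> \<le> infdist x ?L"
    using z by (subst infdist_notempty) blast+
qed

text \<open>Coordinates centred at the focus: \<open>n\<close> is the unit normal of the directrix
  towards the focus, \<open>m\<close> its quarter turn, \<open>d\<close> the distance from focus to
  directrix. The equation is the squared focus-directrix condition.\<close>

lemma parabola_equation:
  assumes "parabola S"
  obtains d :: real and m n F :: "real^2" where "0 < d" "m \<bullet> m = 1" "n \<bullet> n = 1" "m \<bullet> n = 0"
    "\<And>v. v \<bullet> v = (m \<bullet> v)\<^sup>2 + (n \<bullet> v)\<^sup>2"
    "\<And>x. x \<in> S \<longleftrightarrow> (m \<bullet> (x - F))\<^sup>2 = 2 * d * (n \<bullet> (x - F)) + d\<^sup>2"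
proof -
  obtain F L where L: "affine L" "aff_dim L = 1" "F \<notin> L" and S: "S = {x. dist x F = infdist x L}"
    using assms unfolding parabola_def by blast
  obtain a b where ab: "a \<noteq> 0" "L = {x. a \<bullet> x = b}"
    using aff_dim_eq_hyperplane[of L] L(1,2) hull_same[of affine L] by auto
  \<comment> \<open>This sign orients the normal so that \<open>d\<close> is positive.\<close>
  define \<sigma> where "\<sigma> = sgn (a \<bullet> F - b)"
  define n where "n = (\<sigma> / norm a) *\<^sub>R a"
  define c where "c = \<sigma> * b / norm a"
  define d where "d = n \<bullet> F - c"
  define m :: "real^2" where "m = vector [- n $ 2, n $ 1]"
  have F: "a \<bullet> F - b \<noteq> 0" using L(3) ab(2) by simp
  then have \<sigma>: "\<bar>\<sigma>\<bar> = 1" unfolding \<sigma>_def by (simp add: abs_sgn_eq)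
  have "\<bar>a \<bullet> F - b\<bar> = \<sigma> * (a \<bullet> F - b)"
    unfolding \<sigma>_def by (simp only: abs_sgn mult.commute)
  then have d: "d = \<bar>a \<bullet> F - b\<bar> / norm a"
    unfolding d_def n_def c_def by (simp add: diff_divide_distrib right_diff_distrib)
  then have "0 < d" using F ab(1) by simp
  have norm_n: "norm n = 1" unfolding n_def using \<sigma> ab(1) by simp
  have L_eq: "L = {x. n \<bullet> x = c}"
    unfolding n_def c_def ab(2) using \<sigma> ab(1) by auto
  have n: "n $ 1 * n $ 1 + n $ 2 * n $ 2 = 1"
    using norm_n by (simp add: norm_eq_1 inner_vec_def sum_2)
  have m: "m $ 1 = - n $ 2" "m $ 2 = n $ 1" unfolding m_def by simp_all
  have split: "v \<bullet> v = (m \<bullet> v)\<^sup>2 + (n \<bullet> v)\<^sup>2" for v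
  proof -
    have "(m \<bullet> v)\<^sup>2 + (n \<bullet> v)\<^sup>2 = (n $ 1 * n $ 1 + n $ 2 * n $ 2) * (v \<bullet> v)"
      unfolding inner_vec_def sum_2 m by (simp add: power2_eq_square algebra_simps)
    then show ?thesis unfolding n by simp
  qed
  have "x \<in> S \<longleftrightarrow> (m \<bullet> (x - F))\<^sup>2 = 2 * d * (n \<bullet> (x - F)) + d\<^sup>2" for x
  proof -
    have "x \<in> S \<longleftrightarrow> norm (x - F) = \<bar>n \<bullet> x - c\<bar>"
      unfolding S L_eq infdist_hyperplane[OF norm_n] by (simp add: dist_norm)
    also have "\<dots> \<longleftrightarrow> (norm (x - F))\<^sup>2 = \<bar>n \<bullet> x - c\<bar>\<^sup>2"
      by (simp only: power2_eq_iff_nonneg[OF norm_ge_zero abs_ge_zero])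
    also have "\<dots> \<longleftrightarrow> (m \<bullet> (x - F))\<^sup>2 + (n \<bullet> (x - F))\<^sup>2 = (n \<bullet> (x - F) + d)\<^sup>2"
      unfolding power2_norm_eq_inner split[of "x - F"] power2_abs by (simp add: d_def inner_diff_right)
    also have "\<dots> \<longleftrightarrow> (m \<bullet> (x - F))\<^sup>2 = 2 * d * (n \<bullet> (x - F)) + d\<^sup>2"
      unfolding power2_sum by auto
    finally show ?thesis .
  qed
  moreover have "m \<bullet> m = 1" "n \<bullet> n = 1" "m \<bullet> n = 0"
    using n by (simp_all add: inner_vec_def sum_2 m)
  ultimately show thesis using that[OF \<open>0 < d\<close>] split by blast
qed

lemma closed_parabola:
  assumes "parabola S"
  shows "closed S"
proof -
  obtain F L where "S = {x. dist x F = infdist x L}"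
    using assms unfolding parabola_def by blast
  then show ?thesis
    by (simp only:) (intro closed_Collect_eq continuous_intros)
qed

text \<open>A function with slope at most 1 cannot cover the whole line from an interval that is bounded on
  one side.\<close>

lemma interval_surj_short_imp_UNIV:
  fixes u u' :: "real \<Rightarrow> real"
  assumes "open J" "connected J" "J \<noteq> {}"
    and deriv: "\<And>s. s \<in> J \<Longrightarrow> (u has_real_derivative u' s) (at s)"
    and u': "\<And>s. s \<in> J \<Longrightarrow> 0 \<le> u' s" "\<And>s. s \<in> J \<Longrightarrow> u' s \<le> 1"
    and surj: "u ` J = UNIV"
  shows "J = UNIV"
proof (rule ccontr)
  assume "J \<noteq> UNIV"
  then obtain z where "z \<notin> J" by blast
  obtain s0 where s0: "s0 \<in> J" using assms(3) by blast
  have sub: "{s..t} \<subseteq> J" if "s \<in> J" "t \<in> J" for s t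
    using connected_contains_Icc[OF assms(2) that] .
  have mono: "u s \<le> u t" "s - u s \<le> t - u t" if st: "s \<in> J" "t \<in> J" "s \<le> t" for s t
  proof -
    show "u s \<le> u t"
    proof (rule DERIV_nonneg_imp_nondecreasing[OF st(3)])
      fix r assume "s \<le> r" "r \<le> t"
      then have "r \<in> J" using sub[OF st(1,2)] by auto
      then show "\<exists>w. (u has_real_derivative w) (at r) \<and> 0 \<le> w" using deriv u'(1) by blast
    qed
    show "s - u s \<le> t - u t"
    proof (rule DERIV_nonneg_imp_nondecreasing[OF st(3)])
      fix r assume "s \<le> r" "r \<le> t"
      then have "r \<in> J" using sub[OF st(1,2)] by auto
      then have "((\<lambda>s. s - u s) has_real_derivative 1 - u' r) (at r)" "0 \<le> 1 - u' r"
        using DERIV_diff[OF DERIV_ident deriv] u'(2) by simp_all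
      then show "\<exists>w. ((\<lambda>s. s - u s) has_real_derivative w) (at r) \<and> 0 \<le> w" by blast
    qed
  qed
  show False
  proof (cases "s0 < z")
    case True
    \<comment> \<open>All of \<open>J\<close> lies left of \<open>z\<close>, so \<open>u\<close>
      rises by less than \<open>z - s0\<close> after \<open>s0\<close>; the extra 1 makes the bound
      strict, so its value is missed.\<close>
    have "u s < u s0 + (z - s0) + 1" if s: "s \<in> J" for s
    proof (cases "s \<le> s0")
      case False
      have "s < z"
      proof (rule ccontr)
        assume "\<not> s < z"
        then have "z \<in> {s0..s}" using True by simp
        then show False using sub[OF s0 s] \<open>z \<notin> J\<close> by blast
      qed
      then show ?thesis using mono(2)[OF s0 s] False by simp
    qed (use mono(1)[OF s s0] True in simp)
    moreover obtain s where "s \<in> J" "u s = u s0 + (z - s0) + 1" using surj by (metis UNIV_I imageE)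
    ultimately show False by force
  next
    case False
    then have "z < s0" using s0 \<open>z \<notin> J\<close> by (cases "z = s0") auto
    have "u s0 - (s0 - z) - 1 < u s" if s: "s \<in> J" for s
    proof (cases "s0 \<le> s")
      case False
      have "z < s"
      proof (rule ccontr)
        assume "\<not> z < s"
        then have "z \<in> {s..s0}" using \<open>z < s0\<close> by simp
        then show False using sub[OF s s0] \<open>z \<notin> J\<close> by blast
      qed
      then show ?thesis using mono(2)[OF s s0] False by simp
    qed (use mono(1)[OF s0 s] \<open>z < s0\<close> in simp)
    moreover obtain s where "s \<in> J" "u s = u s0 - (s0 - z) - 1" using surj by (metis UNIV_I imageE)
    ultimately show False by force
  qed
qed

lemma increasing_bij_inverse_continuous:
  fixes u :: "real \<Rightarrow> real"
  assumes "strict_mono u" "continuous_on UNIV u" "surj u"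
  shows "continuous_on UNIV (inv u)"
proof -
  have inv: "inv u (u z) = z" for z
    using strict_mono_imp_inj_on[OF assms(1)] by simp
  have "isCont (inv u) (u x)" for x
    using assms(2) inv by (intro isCont_inverse_function[of 1 x "inv u" u])
      (simp_all add: continuous_on_eq_continuous_at)
  then show ?thesis
    using assms(3) by (metis continuous_at_imp_continuous_on surjD)
qed

text \<open>Since \<open>u\<close> takes all real values with slope between 0 and 1, the domain is
  the whole line and the angle \<open>arctan (u / d)\<close> sweeps an open interval of length
  \<open>pi\<close>. This length is approached but not attained, hence the \<open>e\<close>.\<close>

lemma parabola_parametrization:
  assumes planar: "planar_curve J P" and par: "parabola (P ` J)"
  obtains \<phi> where "J = UNIV" "complete_closed_embedded UNIV P"
    "\<And>s. (\<phi> has_real_derivative curvature P s) (at s)" "\<And>s. 0 < curvature P s"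
    "\<And>e. 0 < e \<Longrightarrow> \<exists>s t. pi - e < \<phi> t - \<phi> s"
proof (rule parabola_equation[OF par])
  fix d :: real and m0 n F :: "real^2"
  assume d: "0 < d" and onb0: "m0 \<bullet> m0 = 1" "n \<bullet> n = 1" "m0 \<bullet> n = 0"
    and split0: "\<And>v. v \<bullet> v = (m0 \<bullet> v)\<^sup>2 + (n \<bullet> v)\<^sup>2"
    and eq0: "\<And>x. x \<in> P ` J \<longleftrightarrow> (m0 \<bullet> (x - F))\<^sup>2 = 2 * d * (n \<bullet> (x - F)) + d\<^sup>2"
  have J: "open J" "connected J" "J \<noteq> {}" using planar unfolding planar_curve_def by blast+
  define T where "T = iter_deriv 1 P"
  define K where "K = iter_deriv 2 P"
  have P: "(P has_vector_derivative T s) (at s)" and T: "(T has_vector_derivative K s) (at s)"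
    if "s \<in> J" for s
    using planar_curveD(1)[OF planar that, of 0] planar_curveD(1)[OF planar that, of 1]
    unfolding T_def K_def by (simp_all add: iter_deriv_def numeral_2_eq_2)
  have contT: "isCont T s" and normT: "norm (T s) = 1" if "s \<in> J" for s
    unfolding T_def by (rule planar_curveD(2,3)[OF planar that])+
  have PF: "((\<lambda>s. m \<bullet> (P s - F)) has_real_derivative m \<bullet> T s) (at s)" if "s \<in> J" for s m
    using DERIV_diff[OF has_real_derivative_inner_right[OF P[OF that], of m] DERIV_const[of "m \<bullet> F"]]
    by (simp add: inner_diff_right)
  \<comment> \<open>The derivative of the parabola equation along the curve, divided by 2.\<close>
  have slope: "d * (n \<bullet> T s) = (m0 \<bullet> (P s - F)) * (m0 \<bullet> T s)" if "s \<in> J" for s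
  proof -
    have sq: "((\<lambda>s. (m0 \<bullet> (P s - F)) * (m0 \<bullet> (P s - F))) has_real_derivative
        (m0 \<bullet> (P s - F)) * (m0 \<bullet> T s) + (m0 \<bullet> T s) * (m0 \<bullet> (P s - F))) (at s)"
      by (rule DERIV_mult'[OF PF[OF that] PF[OF that]])
    have sq_eq: "(m0 \<bullet> (P r - F)) * (m0 \<bullet> (P r - F)) = 2 * d * (n \<bullet> (P r - F)) + d\<^sup>2" if "r \<in> J" for r
      using eq0[of "P r"] that by (simp add: power2_eq_square)
    have "((\<lambda>s. 2 * d * (n \<bullet> (P s - F)) + d\<^sup>2) has_real_derivative
        (m0 \<bullet> (P s - F)) * (m0 \<bullet> T s) + (m0 \<bullet> T s) * (m0 \<bullet> (P s - F))) (at s)"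
      by (rule has_field_derivative_transform_within_open[OF sq J(1) that sq_eq])
    moreover have "((\<lambda>s. 2 * d * (n \<bullet> (P s - F)) + d\<^sup>2) has_real_derivative 2 * d * (n \<bullet> T s) + 0) (at s)"
      by (intro DERIV_add DERIV_cmult DERIV_const PF that)
    ultimately have "(m0 \<bullet> (P s - F)) * (m0 \<bullet> T s) + (m0 \<bullet> T s) * (m0 \<bullet> (P s - F)) = 2 * d * (n \<bullet> T s) + 0"
      by (rule DERIV_unique)
    then show ?thesis by (simp add: mult.commute)
  qed
  \<comment> \<open>The curve thus never runs parallel to the axis, and a sign change of
    \<open>m0\<close> makes its abscissa increasing.\<close>
  have "m0 \<bullet> T s \<noteq> 0" if "s \<in> J" for s
  proof
    assume 0: "m0 \<bullet> T s = 0"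
    then have "n \<bullet> T s = 0" using slope[OF that] d by simp
    with 0 have "T s \<bullet> T s = 0" using split0[of "T s"] by simp
    then show False using normT[OF that] by simp
  qed
  moreover have "continuous_on J (\<lambda>s. m0 \<bullet> T s)"
    using contT by (intro continuous_on_inner continuous_on_const continuous_at_imp_continuous_on) blast
  ultimately obtain \<sigma> :: real where \<sigma>: "\<sigma> = 1 \<or> \<sigma> = -1" "\<And>s. s \<in> J \<Longrightarrow> 0 < \<sigma> * (m0 \<bullet> T s)"
    using nonvanishing_constant_sign[OF _ J(2), of "\<lambda>s. m0 \<bullet> T s"] by blast
  define m where "m = \<sigma> *\<^sub>R m0"
  have m_sq: "(m \<bullet> v)\<^sup>2 = (m0 \<bullet> v)\<^sup>2" and m_prod: "(m0 \<bullet> v) * (m0 \<bullet> w) = (m \<bullet> v) * (m \<bullet> w)" for v w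
    using \<sigma>(1) unfolding m_def by (auto simp: power2_eq_square)
  have onb: "m \<bullet> m = 1" "m \<bullet> n = 0" using \<sigma>(1) onb0 unfolding m_def by auto
  have split: "v \<bullet> v = (m \<bullet> v)\<^sup>2 + (n \<bullet> v)\<^sup>2" for v
    using split0 m_sq by simp
  define u where "u s = m \<bullet> (P s - F)" for s
  define \<phi> where "\<phi> s = arctan (u s / d)" for s
  define k where "k s = inverse (1 + (u s / d)\<^sup>2) * (m \<bullet> T s / d)" for s
  have u: "(u has_real_derivative m \<bullet> T s) (at s)" if "s \<in> J" for s
    unfolding u_def by (rule PF[OF that])
  have pos: "0 < m \<bullet> T s" if "s \<in> J" for s using \<sigma>(2)[OF that] unfolding m_def by simp
  have \<phi>: "(\<phi> has_real_derivative k s) (at s)" if "s \<in> J" for s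
    unfolding \<phi>_def k_def by (rule DERIV_chain2[OF DERIV_arctan DERIV_cdivide[OF u[OF that]]])
  have k_pos: "0 < k s" if "s \<in> J" for s
    unfolding k_def using pos[OF that] d by (intro mult_pos_pos) (auto simp: add_pos_nonneg)
  have nT: "n \<bullet> T s = u s / d * (m \<bullet> T s)" if "s \<in> J" for s
    using slope[OF that] d unfolding m_prod u_def by (simp add: field_simps)
  \<comment> \<open>By \<open>nT\<close> the tangent has slope \<open>u s / d\<close>, the tangent
    of \<open>\<phi> s\<close>; unit speed and positivity fix its components as cosine and
    sine.\<close>
  have mT: "m \<bullet> T s = cos (\<phi> s)" if "s \<in> J" for s
  proof -
    have "(m \<bullet> T s)\<^sup>2 + (u s / d * (m \<bullet> T s))\<^sup>2 = 1"
      using split[of "T s"] normT[OF that] unfolding nT[OF that] by (simp add: norm_eq_1)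
    then have "(m \<bullet> T s)\<^sup>2 * (1 + (u s / d)\<^sup>2) = 1"
      by (simp only: power_mult_distrib distrib_left mult_1_right mult.commute)
    then have "sqrt ((m \<bullet> T s)\<^sup>2 * (1 + (u s / d)\<^sup>2)) = 1" by simp
    then have "(m \<bullet> T s) * sqrt (1 + (u s / d)\<^sup>2) = 1"
      using pos[OF that] by (simp only: real_sqrt_mult real_sqrt_abs abs_of_pos)
    moreover have "0 < sqrt (1 + (u s / d)\<^sup>2)" by (simp add: add_pos_nonneg)
    ultimately show ?thesis unfolding \<phi>_def cos_arctan by (simp add: eq_divide_eq)
  qed
  have nT': "n \<bullet> T s = sin (\<phi> s)" if "s \<in> J" for s
    unfolding nT[OF that] mT[OF that] \<phi>_def cos_arctan sin_arctan by simp
  have curv: "curvature P s = k s" if "s \<in> J" for s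
  proof -
    have "((\<lambda>s. cos (\<phi> s)) has_real_derivative m \<bullet> K s) (at s)"
      by (rule has_field_derivative_transform_within_open[
            OF has_real_derivative_inner_right[OF T[OF that]] J(1) that mT])
    then have mK: "m \<bullet> K s = - sin (\<phi> s) * k s"
      by (rule DERIV_unique[OF _ DERIV_chain2[OF DERIV_cos \<phi>[OF that]]])
    have "((\<lambda>s. sin (\<phi> s)) has_real_derivative n \<bullet> K s) (at s)"
      by (rule has_field_derivative_transform_within_open[
            OF has_real_derivative_inner_right[OF T[OF that]] J(1) that nT'])
    then have nK: "n \<bullet> K s = cos (\<phi> s) * k s"
      by (rule DERIV_unique[OF _ DERIV_chain2[OF DERIV_sin \<phi>[OF that]]])
    have "(norm (K s))\<^sup>2 = ((sin (\<phi> s))\<^sup>2 + (cos (\<phi> s))\<^sup>2) * (k s)\<^sup>2"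
      unfolding power2_norm_eq_inner split[of "K s"] mK nK by (simp only: power_mult_distrib power2_minus distrib_right)
    then have "sqrt ((norm (K s))\<^sup>2) = sqrt ((k s)\<^sup>2)" by simp
    then show ?thesis unfolding curvature_def K_def using k_pos[OF that] by simp
  qed
  have surj: "u ` J = UNIV"
  proof -
    have "r \<in> u ` J" for r
    proof -
      \<comment> \<open>The point of the parabola with abscissa \<open>r\<close>, its ordinate
        solved from the equation.\<close>
      define x where "x = F + r *\<^sub>R m + ((r\<^sup>2 - d\<^sup>2) / (2 * d)) *\<^sub>R n"
      have mx: "m \<bullet> (x - F) = r" and nx: "n \<bullet> (x - F) = (r\<^sup>2 - d\<^sup>2) / (2 * d)"
        unfolding x_def using onb onb0 by (simp_all add: inner_add_right inner_commute[of n m])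
      have "x \<in> P ` J"
        unfolding eq0 m_sq[symmetric] mx nx using d by simp
      then show ?thesis using mx unfolding u_def by force
    qed
    then show ?thesis by blast
  qed
  have UNIV: "J = UNIV"
    by (rule interval_surj_short_imp_UNIV[OF J u _ _ surj]) (use pos mT in \<open>auto simp: less_imp_le\<close>)
  have mono: "strict_mono u"
    by (rule strict_monoI, rule DERIV_pos_imp_increasing[where f = u]) (use u pos UNIV in blast)+
  have cont_u: "continuous_on UNIV u"
    using u UNIV by (intro DERIV_continuous_on[of UNIV u]) auto
  \<comment> \<open>The abscissa determines the parameter because \<open>u\<close> is increasing and
    onto.\<close>
  have "homeomorphism UNIV (range P) P (\<lambda>x. inv u (m \<bullet> (x - F)))"
  proof (rule homeomorphismI)
    show "continuous_on UNIV P"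
      using has_vector_derivative_continuous[OF P] UNIV by (intro continuous_at_imp_continuous_on) blast
    show "continuous_on (range P) (\<lambda>x. inv u (m \<bullet> (x - F)))"
      by (rule continuous_on_compose2[OF increasing_bij_inverse_continuous[OF mono cont_u]])
        (use surj UNIV in \<open>auto intro!: continuous_intros\<close>)
    show inv: "inv u (m \<bullet> (P s - F)) = s" for s
      using strict_mono_imp_inj_on[OF mono] unfolding u_def[symmetric] by simp
    show "P (inv u (m \<bullet> (x - F))) = x" if "x \<in> range P" for x
      using that inv by auto
  qed auto
  then have emb: "complete_closed_embedded UNIV P"
    using planar closed_parabola[OF par] complete_UNIV UNIV
    unfolding complete_closed_embedded_def complete_curve_def embedded_curve_def by blast
  have "\<exists>s t. pi - e < \<phi> t - \<phi> s" if "0 < e" for e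
  proof -
    \<comment> \<open>\<open>2 * a\<close> is at least \<open>pi - e / 2\<close>; the maximum with 0
      keeps \<open>a\<close> in the range of \<open>arctan\<close> for large
      \<open>e\<close>.\<close>
    define a where "a = max 0 (pi / 2 - e / 4)"
    have a: "- (pi / 2) < a" "a < pi / 2" "pi - e < 2 * a"
      unfolding a_def using that pi_gt_zero by (auto simp: max_def)
    obtain s t where "u s = d * tan (- a)" "u t = d * tan a"
      using surj by (metis UNIV_I imageE)
    then have "\<phi> s = - a" "\<phi> t = a"
      unfolding \<phi>_def using d a arctan_tan[of a] arctan_tan[of "- a"] by simp_all
    then have "pi - e < \<phi> t - \<phi> s" using a(3) by simp
    then show ?thesis by blast
  qed
  then show thesis
    using \<phi> curv k_pos UNIV by (intro that[OF UNIV emb]) simp_all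
qed

section \<open>Comparison of total turning with the parabola\<close>

theorem theorem6p3:
  fixes P :: "real \<Rightarrow> real^2" and J :: "real set"
  assumes "planar_curve J P" and "parabola (P ` J)"
  shows "complete_closed_embedded J P \<and>
         \<not> (\<exists>I C. complete_closed_embedded I C \<and> more_curved I C J P)"
proof -
  obtain \<phi> where J: "J = UNIV" and P: "complete_closed_embedded UNIV P"
    and \<phi>: "\<And>s. (\<phi> has_real_derivative curvature P s) (at s)" and pos: "\<And>s. 0 < curvature P s"
    and wide: "\<And>e. 0 < e \<Longrightarrow> \<exists>s t. pi - e < \<phi> t - \<phi> s"
    using parabola_parametrization[OF assms] by blast
  have False if C: "complete_closed_embedded I C" and more: "more_curved I C J P" for I C
  proof -
    have I: "I = UNIV" and ge: "\<And>s. curvature P s \<le> curvature C s"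
      and gt: "\<exists>s. curvature P s < curvature C s"
      using more J unfolding more_curved_def exceeds_on_def by auto
    have "0 < curvature C s" for s using pos[of s] ge[of s] by linarith
    then obtain \<theta> where \<theta>: "\<And>s. (\<theta> has_real_derivative curvature C s) (at s)"
      and turn: "\<And>s t. \<theta> t - \<theta> s \<le> pi"
      using closed_embedded_curve_turning_le_pi[of C] C I by blast
    \<comment> \<open>The excess of turning over the parabola: nondecreasing, and strictly growing
      just after a point of larger curvature.\<close>
    define h where "h = (\<lambda>s. \<theta> s - \<phi> s)"
    have h: "(h has_real_derivative curvature C s - curvature P s) (at s)" for s
      unfolding h_def by (rule DERIV_diff[OF \<theta> \<phi>])
    have h_mono: "h s \<le> h t" if "s \<le> t" for s t
      by (rule DERIV_nonneg_imp_nondecreasing[OF that]) (use h ge diff_ge_0_iff_ge in blast)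
    have \<phi>_mono: "\<phi> s \<le> \<phi> t" if "s \<le> t" for s t
      by (rule DERIV_nonneg_imp_nondecreasing[OF that]) (use \<phi> pos less_imp_le in blast)
    obtain a where "0 < curvature C a - curvature P a" using gt by (auto simp: algebra_simps)
    then obtain e where e: "0 < e" "\<And>r. 0 < r \<Longrightarrow> r < e \<Longrightarrow> h a < h (a + r)"
      using DERIV_pos_inc_right[OF h] by blast
    define b where "b = a + e / 2"
    have "a < b" "h a < h b" unfolding b_def using e(2)[of "e / 2"] e(1) by simp_all
    \<comment> \<open>The gain \<open>h b - h a\<close> is fixed first; then the turning of the
      parabola from \<open>s\<close> to \<open>t\<close> misses \<open>pi\<close> by less than this
      gain. Enlarging the interval to contain \<open>a\<close> and \<open>b\<close> preserves both
      contributions.\<close>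
    then obtain s t where st: "pi - (h b - h a) < \<phi> t - \<phi> s" using wide[of "h b - h a"] by auto
    have "\<phi> t - \<phi> s \<le> \<phi> (max t b) - \<phi> (min s a)"
      using \<phi>_mono[of t "max t b"] \<phi>_mono[of "min s a" s] by simp
    moreover have "h b - h a \<le> h (max t b) - h (min s a)"
      using h_mono[of b "max t b"] h_mono[of "min s a" a] by simp
    ultimately have "pi < \<theta> (max t b) - \<theta> (min s a)" using st unfolding h_def by linarith
    then show False using turn[of "max t b" "min s a"] by linarith
  qed
  then show ?thesis using P J by blast
qed

end
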